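(* Let $G=(V,E)$ be an amply regular graph with parameters $(n,d,\alpha,\beta)$ such that $n<3d-2\alpha$. Suppose that one of the following conditions holds: (1) $\beta=\alpha+1$ and $d> \alpha+\sqrt{6\alpha+\frac{1}{4}}+\frac{3}{2}$; (2) $\beta\ge\alpha+2$ and $d \ge \frac{3}{2}\beta + \frac{1}{2}\sqrt{4\alpha^2-3\beta^2+28\beta}$; (3) $\beta \geq \frac{2\sqrt{3}}{3}\alpha + 7$. Then for every $xy\in E$ there exists a perfect matching between $N_x$ and $N_y$, where $N_x:=\Gamma(x)\setminus(\Delta_{xy}\cup\{y\})$, $N_y:=\Gamma(y)\setminus(\Delta_{xy}\cup\{x\})$ and $\Delta_{xy}:=\Gamma(x)\cap\Gamma(y)$.
   Context: Graphs are simple and undirected. A $d$-regular graph $G$ with $n$ vertices which is neither complete nor empty (i.e. has at least one edge) is called amply regular with parameters $(n,d,\alpha,\beta)$ if any two adjacent vertices have exactly $\alpha$ common neighbors and any two vertices at distance $2$ have exactly $\beta$ common neighbors. For a vertex $x$, $\Gamma(x):=\{z\in V\mid xz\in E\}$ is its set of neighbors. A perfect matching between $N_x$ and $N_y$ is a set of pairwise disjoint edges of $G$, each joining a vertex of $N_x$ to a vertex of $N_y$, which together cover every vertex of $N_x\cup N_y$; equivalently, a bijection $\phi:N_x\to N_y$ with $v\phi(v)\in E$ for all $v\in N_x$. *)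

theory Defs
  imports "Graph_Theory.Graph_Theory" "HOL-Library.Disjoint_Sets"
begin

text \<open>
  The locale \<^locale>\<open>graph\<close> describes finite simple undirected graphs, represented as symmetric
  digraphs: finite vertex set, no loops, no parallel arcs, and every edge \<open>uv\<close> given by
  the two arcs \<open>u \<rightarrow> v\<close> and \<open>v \<rightarrow> u\<close>.  Adjacency is \<open>u \<rightarrow>\<^bsub>G\<^esub> v\<close>.
\<close>

definition neighbors :: "('a, 'b) pre_digraph \<Rightarrow> 'a \<Rightarrow> 'a set" (\<open>\<Gamma>\<index> _\<close> [1000] 999) where
  "neighbors G x = {z \<in> verts G. x \<rightarrow>\<^bsub>G\<^esub> z}"

text \<open>
  \<open>\<mu> (\<lambda>_. 1) u v\<close> is the library's shortest-path distance for unit arc weights, i.e. the usual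
  graph distance (it is \<open>\<infinity>\<close> if there is no walk from \<open>u\<close> to \<open>v\<close>).
\<close>

locale amply_regular = graph G
  for G :: "('a, 'b) pre_digraph" (structure)
    and n d \<alpha> \<beta> :: nat +
  assumes num_verts: "card (verts G) = n"
    and regular: "\<And>v. v \<in> verts G \<Longrightarrow> card (\<Gamma> v) = d"
    and not_complete: "\<not> complete_digraph n G"
    and not_empty: "arcs G \<noteq> {}"
    and common_adjacent: "\<And>u v. \<lbrakk>u \<in> verts G; v \<in> verts G; u \<rightarrow> v\<rbrakk> \<Longrightarrow> card (\<Gamma> u \<inter> \<Gamma> v) = \<alpha>"
    and common_dist2:
      "\<And>u v. \<lbrakk>u \<in> verts G; v \<in> verts G; \<mu> (\<lambda>_. 1) u v = 2\<rbrakk> \<Longrightarrow> card (\<Gamma> u \<inter> \<Gamma> v) = \<beta>"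

text \<open>
  A matching is a set of undirected edges, hence its members are the two-element sets \<open>{u, v}\<close>
  rather than arcs.
\<close>

definition perfect_matching_between ::
  "('a, 'b) pre_digraph \<Rightarrow> 'a set \<Rightarrow> 'a set \<Rightarrow> 'a set set \<Rightarrow> bool" where
  "perfect_matching_between G A B M \<longleftrightarrow>
     (\<forall>e \<in> M. \<exists>u \<in> A. \<exists>v \<in> B. u \<rightarrow>\<^bsub>G\<^esub> v \<and> e = {u, v}) \<and>
     disjoint M \<and>
     A \<union> B \<subseteq> \<Union>M"

definition common_neighbors :: "('a, 'b) pre_digraph \<Rightarrow> 'a \<Rightarrow> 'a \<Rightarrow> 'a set" where
  "common_neighbors G x y = neighbors G x \<inter> neighbors G y"

definition private_neighbors :: "('a, 'b) pre_digraph \<Rightarrow> 'a \<Rightarrow> 'a \<Rightarrow> 'a set" where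
  "private_neighbors G x y = neighbors G x - (common_neighbors G x y \<union> {y})"

text \<open>The distance-two hypothesis of \<^locale>\<open>amply_regular\<close> in elementary terms.\<close>

lemma (in graph) dist_eq_2_iff:
  assumes "u \<in> verts G" "v \<in> verts G"
  shows "\<mu> (\<lambda>_. 1) u v = 2 \<longleftrightarrow> u \<noteq> v \<and> \<not> u \<rightarrow> v \<and> \<Gamma> u \<inter> \<Gamma> v \<noteq> {}"
proof -
  have cost: "awalk_cost (\<lambda>_. 1) p = real (length p)" for p
    by (simp add: awalk_cost_def sum_list_triv)
  have len0: "u = v" if "awalk u [] v" using that by (simp add: awalk_Nil_iff)
  have len1: "u \<rightarrow> v" if "awalk u [e] v" for e
    using that by (auto simp: awalk_Cons_iff awalk_Nil_iff arcs_ends_conv)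
  have le: "\<mu> (\<lambda>_. 1) u v \<le> ereal (length p)" if "awalk u p v" for p
    using min_cost_le_walk_cost[OF that, of "\<lambda>_. 1"] cost by simp
  have ge: "\<mu> (\<lambda>_. 1) u v \<ge> ereal k" if "\<And>p. awalk u p v \<Longrightarrow> k \<le> real (length p)" for k
    unfolding \<mu>_def by (rule INF_greatest) (simp add: cost that)
  have inf: "awalk u p v \<Longrightarrow> length p \<ge> 2" if "u \<noteq> v" "\<not> u \<rightarrow> v" for p
    using that len0 len1 by (cases p; cases "tl p") auto
  have two: "\<exists>p. awalk u p v \<and> length p = 2" if "u \<rightarrow> w" "w \<rightarrow> v" for w
  proof -
    obtain e f where "e \<in> arcs G" "tail G e = u" "head G e = w"
      "f \<in> arcs G" "tail G f = w" "head G f = v"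
      using \<open>u \<rightarrow> w\<close> \<open>w \<rightarrow> v\<close> by (auto simp: arcs_ends_conv)
    then have "awalk u [e, f] v" using assms by (auto simp: awalk_Cons_iff awalk_Nil_iff)
    then show ?thesis by force
  qed
  have symd: "a \<rightarrow> b \<longleftrightarrow> b \<rightarrow> a" for a b
    using arcs_ends_symmetric[OF sym_arcs] by blast
  show ?thesis
  proof
    assume 2: "\<mu> (\<lambda>_. 1) u v = 2"
    have "u \<noteq> v"
      using le[of "[]"] 2 assms by (auto simp: awalk_Nil_iff zero_ereal_def[symmetric])
    moreover have "\<not> u \<rightarrow> v"
    proof
      assume "u \<rightarrow> v"
      then obtain e where "e \<in> arcs G" "tail G e = u" "head G e = v"
        by (auto simp: arcs_ends_conv)
      then have "awalk u [e] v" using assms by (auto simp: awalk_Cons_iff awalk_Nil_iff)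
      from le[OF this] 2 show False by (simp add: one_ereal_def[symmetric])
    qed
    moreover have "\<exists>p. awalk u p v \<and> length p = 2"
    proof (rule ccontr)
      assume "\<not> ?thesis"
      then have "awalk u p v \<Longrightarrow> length p \<ge> 3" for p
        using inf[OF calculation, of p] by (cases "length p = 2") auto
      then have "\<mu> (\<lambda>_. 1) u v \<ge> ereal 3" by (intro ge) force
      then show False using 2 by simp
    qed
    then obtain e f where "awalk u [e, f] v"
      by (auto simp: length_Suc_conv numeral_2_eq_2)
    then have "u \<rightarrow> head G e" "head G e \<rightarrow> v" "head G e \<in> verts G"
      by (auto simp: awalk_Cons_iff awalk_Nil_iff arcs_ends_conv intro: rev_image_eqI)
    then have "\<Gamma> u \<inter> \<Gamma> v \<noteq> {}" using symd by (auto simp: neighbors_def)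
    ultimately show "u \<noteq> v \<and> \<not> u \<rightarrow> v \<and> \<Gamma> u \<inter> \<Gamma> v \<noteq> {}" by blast
  next
    assume R: "u \<noteq> v \<and> \<not> u \<rightarrow> v \<and> \<Gamma> u \<inter> \<Gamma> v \<noteq> {}"
    then obtain w where "u \<rightarrow> w" "w \<rightarrow> v" using symd by (auto simp: neighbors_def)
    from two[OF this] have "\<mu> (\<lambda>_. 1) u v \<le> 2" using le by fastforce
    moreover have "\<mu> (\<lambda>_. 1) u v \<ge> ereal 2" using R inf by (intro ge) force
    ultimately show "\<mu> (\<lambda>_. 1) u v = 2" by simp
  qed
qed

end

theory Submission
  imports Defs "HOL-Analysis.Convex"
begin

text \<open>
  Fix an edge \<open>xy\<close>, let \<open>D\<close> be the set of common neighbors and \<open>N = d - \<alpha> - 1\<close> the number of private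
  neighbors of either end.  The hypothesis on \<open>n\<close> says that at most \<open>N\<close> vertices are adjacent to
  neither \<open>x\<close> nor \<open>y\<close>.  By Hall's theorem (\<open>hall_marriage\<close>) a missing perfect matching yields a set of
  private neighbors of one end with too few neighbors among those of the other.  Passing to the
  non-neighbors on the other side if necessary, there is such a set \<open>T\<close> of size \<open>\<tau>\<close> with
  \<open>2 * \<tau> \<le> N + 1\<close>, say in the neighborhood of \<open>y\<close>.

  Let \<open>b w\<close> be the number of neighbors of a vertex \<open>w\<close> in \<open>T\<close>.  The sum of all \<open>(b w)\<^sup>2\<close> is the sum of
  the codegrees of all pairs from \<open>T\<close>.  Two vertices of \<open>T\<close> share the neighbor \<open>y\<close>, so they have
  \<open>\<alpha>\<close> or \<open>\<beta>\<close> common neighbors, and the sum is at most \<open>\<tau> * d + \<tau> * (\<tau> - 1) * \<beta>\<close>.  On the other hand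
  each vertex of \<open>T\<close> has distance one from \<open>y\<close> and two from \<open>x\<close>.  Hence the number \<open>E\<close> of edges between
  \<open>T\<close> and \<open>D\<close> determines the sum of \<open>b\<close> over each part of the vertex set, and the parts are small; in
  particular fewer than \<open>\<tau>\<close> private neighbors of \<open>x\<close> see \<open>T\<close>.  The Cauchy-Schwarz inequality on each
  part turns this into a quadratic inequality for \<open>E\<close> (\<open>square_sum_bound\<close>).  Under each of the three
  conditions its discriminant is negative once \<open>\<alpha> \<ge> 2\<close> and \<open>\<tau> \<ge> 2\<close> (\<open>parameters_exclude_blocking_set\<close>);
  the critical case is \<open>2 * \<tau> = N + 1\<close>.

  Two cases are treated by hand.  If \<open>\<alpha> \<le> 1\<close> and \<open>\<beta> \<ge> 2\<close>, the bipartite graph between the private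
  neighbors is regular of positive degree (\<open>bipartite_regular_expansion\<close>).  If \<open>\<tau> = 1\<close>, a private
  neighbor without any neighbor on the other side would make \<open>d + \<alpha>\<close> both odd and even
  if \<open>D\<close> is nonempty, and force \<open>d = 2\<close> if \<open>D\<close> is empty (\<open>isolated_private_neighbor\<close>).
\<close>

section \<open>The quadratic inequality for a blocking set\<close>

text \<open>
The left-hand side of the conclusion is \<open>- 1 / 4\<close> times the discriminant
of the quadratic in \<open>g\<close>: completing the square shows that the assumption cannot hold when the
discriminant is negative.
\<close>

lemma quadratic_discriminant_bound:
  fixes A w c g B :: real
  assumes "A + w > 0" and "B + A * g\<^sup>2 + w * (g + c)\<^sup>2 \<le> 4 * g + 2 * c"
  shows "A * (w * c\<^sup>2 - 2 * c + B) + w * B + 2 * c * w - 4 \<le> 0"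
proof -
  have "A * (w * c\<^sup>2 - 2 * c + B) + w * B + 2 * c * w - 4
      = (A + w) * (B + A * g\<^sup>2 + w * (g + c)\<^sup>2 - (4 * g + 2 * c)) - ((A + w) * g + c * w - 2)\<^sup>2"
    by (simp add: algebra_simps power2_eq_square)
  moreover have "(A + w) * (B + A * g\<^sup>2 + w * (g + c)\<^sup>2 - (4 * g + 2 * c)) \<le> 0"
    using assms by (intro mult_nonneg_nonpos) auto
  ultimately show ?thesis using zero_le_power2[of "(A + w) * g + c * w - 2"] by linarith
qed

text \<open>
In the application \<open>q + 1\<close> is the size of a set of private neighbors, \<open>N\<close> the number of all of
them, and \<open>N \<ge> 2 * q + 1\<close> says that the set is at most half of \<open>N + 1\<close>.  As a quadratic in \<open>c\<close>, the
expression then has discriminant at most \<open>- (3 * q\<^sup>2 + 4 * q) / (q + 1)\<^sup>2\<close>.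
\<close>

lemma constant_term_pos:
  fixes N q c :: real
  assumes "q > 0" "N \<ge> 2 * q + 1"
  shows "(1 / N + 1 / q) * c\<^sup>2 - 2 * c + (N - c) * q / (q + 1) > 0"
proof -
  have N: "N > 0" using assms by simp
  have "4 * (q + 1)\<^sup>2 * (N + q) * ((N + q) * c\<^sup>2 * (q + 1) - 2 * c * N * q * (q + 1) + (N - c) * q * N * q)
     = (q+1) * ((2 * (N + q) * (q + 1) * c - N * q * (3 * q + 2))\<^sup>2
        + N\<^sup>2 * q\<^sup>2 * (4 * (N - (2 * q + 1)) * (q + 1) + 3 * q\<^sup>2 + 4 * q))"
    by (simp add: algebra_simps power2_eq_square)
  moreover have "\<dots> > 0"
    using assms N by (intro mult_pos_pos add_nonneg_pos add_nonneg_pos mult_nonneg_nonneg) (auto intro!: add_nonneg_pos)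
  ultimately have "4 * (q + 1)\<^sup>2 * (N + q) * ((N + q) * c\<^sup>2 * (q + 1) - 2 * c * N * q * (q + 1) + (N - c) * q * N * q) > 0"
    by simp
  moreover have "4 * (q + 1)\<^sup>2 * (N + q) > 0" using assms N by simp
  ultimately have "(N + q) * c\<^sup>2 * (q + 1) - 2 * c * N * q * (q + 1) + (N - c) * q * N * q > 0"
    by (rule zero_less_mult_pos)
  moreover have "(1 / N + 1 / q) * c\<^sup>2 - 2 * c + (N - c) * q / (q + 1)
     = ((N + q) * c\<^sup>2 * (q + 1) - 2 * c * N * q * (q + 1) + (N - c) * q * N * q) / (N * q * (q + 1))"
    using assms N by (simp add: divide_simps) (simp add: algebra_simps power2_eq_square)
  ultimately show ?thesis using assms N by simp
qed

text \<open>
The part of the bound in \<open>quadratic_discriminant_bound\<close> that stays when \<open>1 / a\<close> is removed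
from \<open>A = 1 / a + 1 / N\<close>.  For \<open>0 \<le> c \<le> N\<close> only \<open>j < 3\<close> can make it negative, where
\<open>j\<close> measures how far the set is from being half of \<open>N + 1\<close>.
\<close>

lemma constant_term_identity:
  fixes N q c j :: real
  assumes "q > 0" "N = 2 * q + 1 + j" "N > 0"
  shows "((1 / N + 1 / q) * c\<^sup>2 - 2 * c + (N - c) * q / (q + 1)) / N
      + (1 / N + 1 / q) * ((N - c) * q / (q + 1)) + 2 * c * (1 / N + 1 / q) - 4
    = (j - 3) / (q + 1) * (1 - c / N) + 2 * c * (1 + j) / (N * q) + c\<^sup>2 * (N + q) / (N\<^sup>2 * q)"
proof -
  have j: "j = N - 2 * q - 1" using assms by simp
  show ?thesis unfolding j using assms(1,3)
    by (simp add: divide_simps) (simp add: algebra_simps power2_eq_square)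
qed

text \<open>
For \<open>a = \<alpha>\<close>, \<open>c = \<beta> - \<alpha> - 1\<close> and \<open>N = d - \<alpha> - 1\<close> the first alternative is
\<open>\<beta> = \<alpha> + 1\<close> with \<open>(d - \<alpha> - 3 / 2)\<^sup>2 > 6 * \<alpha> + 1 / 4\<close>, and the polynomial in the second one is
\<open>d\<^sup>2 - 3 * d * \<beta> + 3 * \<beta>\<^sup>2 - 7 * \<beta> - \<alpha>\<^sup>2\<close>.
\<close>

definition large_parameters :: "real \<Rightarrow> real \<Rightarrow> real \<Rightarrow> bool" where
  "large_parameters a c N \<longleftrightarrow>
     c = 0 \<and> N * (N - 1) > 6 * a \<or>
     c \<ge> 1 \<and> N\<^sup>2 - 3 * c * N + 3 * c\<^sup>2 - N - 4 * c - 6 - a * (N - 3 * c + 5) \<ge> 0"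

text \<open>
The three cases \<open>j \<in> {0, 1, 2}\<close> that the sign in \<open>constant_term_identity\<close> leaves open.  For
\<open>c = 0\<close> and \<open>j = 0\<close> the claim is \<open>N * (N - 1) > 6 * a\<close> up to the factor \<open>N\<close>, which is the source
of the constant \<open>6\<close> in the hypothesis on \<open>d\<close>.
\<close>

lemma near_balanced_excess_pos:
  fixes a c N j :: real
  assumes "large_parameters a c N" "a \<ge> 2" "j = 0 \<or> j = 1 \<or> j = 2" "N \<ge> 3 + j"
  shows "N * (3 * c\<^sup>2 - c * (3 * N + 1 - 3 * j) + N * (N - 1 - j))
    + a * ((2 * j - 6) * (N - c) + 4 * c * (1 + j) + 3 * c\<^sup>2) > 0"
    (is "?W > 0")
proof -
  have N: "N > 0" using assms by auto
  consider (zero) "c = 0" "N * (N - 1) > 6 * a"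
    | (pos) "c \<ge> 1" "N\<^sup>2 - 3 * c * N + 3 * c\<^sup>2 - N - 4 * c - 6 - a * (N - 3 * c + 5) \<ge> 0"
    using assms(1) by (auto simp: large_parameters_def)
  then show ?thesis
  proof cases
    case zero
    have "N * (N - 1 - j) > (6 - 2 * j) * a"
    proof (cases "N \<le> 2 * a")
      case True
      have "j * N \<le> j * (2 * a)" using True assms(3) by (intro mult_left_mono) auto
      then show ?thesis using zero(2) by (simp add: algebra_simps)
    next
      case False
      show ?thesis
      proof (cases "j = 0")
        case False
        then have "N \<ge> 4" using assms(3,4) by auto
        have "(6 - 2 * j) * a = 2 * a * (3 - j)" by (simp add: algebra_simps)
        also have "\<dots> \<le> 2 * a * (N - 1 - j)" using \<open>N \<ge> 4\<close> assms by (intro mult_left_mono) auto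
        also have "\<dots> < N * (N - 1 - j)" using \<open>\<not> N \<le> 2 * a\<close> assms by (intro mult_strict_right_mono) auto
        finally show ?thesis .
      qed (use zero in simp)
    qed
    then have "N * (N * (N - 1 - j) - (6 - 2 * j) * a) > 0" using N by simp
    also have "N * (N * (N - 1 - j) - (6 - 2 * j) * a) = ?W"
      using zero(1) by (simp add: algebra_simps)
    finally show ?thesis .
  next
    case pos
    define p where "p = N\<^sup>2 - 3 * c * N + 3 * c\<^sup>2 - N - 4 * c - 6 - a * (N - 3 * c + 5)"
    define K where "K = N\<^sup>2 - 3 * c * N + 3 * c\<^sup>2 - N + 10 * c"
    have W: "?W = N * p + N * (3 * c + 6) + j * N * (2 * a - (N - 3 * c)) + a * (K + 2 * j * c)"
      unfolding p_def K_def by (simp add: algebra_simps power2_eq_square)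
    have Np: "N * p \<ge> 0" using pos(2) N unfolding p_def by simp
    have K: "K > 0"
    proof -
      \<comment> \<open>Here \<open>N\<^sup>2 - 3 * c * N + 3 * c\<^sup>2 = 3 / 4 * (N - 2 * c)\<^sup>2 + (N / 2)\<^sup>2\<close> absorbs the linear term.\<close>
      have "K = 3 / 4 * (N - 2 * c)\<^sup>2 + (N / 2 - 1)\<^sup>2 + (10 * c - 1)"
        unfolding K_def by (simp add: field_simps power2_eq_square)
      moreover have "3 / 4 * (N - 2 * c)\<^sup>2 \<ge> 0" "(N / 2 - 1)\<^sup>2 \<ge> 0" by simp_all
      ultimately show ?thesis using pos(1) by linarith
    qed
    have Nc: "N * (3 * c + 6) > 0" using N pos(1) by simp
    have j: "0 \<le> j" "j \<le> 2" using assms(3) by auto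
    have "j * N * (2 * a - (N - 3 * c)) + a * (K + 2 * j * c) \<ge> 0"
    proof (cases "N \<le> 3 * c \<or> j = 0")
      case True
      then have "j * N * (2 * a - (N - 3 * c)) \<ge> 0"
        using j N assms(2) by auto
      moreover have "a * (K + 2 * j * c) \<ge> 0" using K assms(2) j pos(1) by simp
      ultimately show ?thesis by linarith
    next
      case False
      then have "j \<ge> 1" "N > 3 * c" using assms(3) by auto
      have "j * N * (2 * a - (N - 3 * c)) + a * (K + 2 * j * c)
        = (a - j) * (N * (N - 3 * c)) + a * N * (2 * j - 1) + a * (3 * c\<^sup>2 + 10 * c + 2 * j * c)"
        unfolding K_def by (simp add: algebra_simps power2_eq_square)
      moreover have "(a - j) * (N * (N - 3 * c)) \<ge> 0"
        using assms(2) j N \<open>N > 3 * c\<close> by (intro mult_nonneg_nonneg) auto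
      moreover have "a * N * (2 * j - 1) \<ge> 0" using assms(2) \<open>j \<ge> 1\<close> N by simp
      moreover have "a * (3 * c\<^sup>2 + 10 * c + 2 * j * c) \<ge> 0" using assms(2) j pos(1) by simp
      ultimately show ?thesis by linarith
    qed
    then show ?thesis using W Np Nc by linarith
  qed
qed

text \<open>
The inequality in \<open>g\<close> is what double counting yields for a set of \<open>q + 1\<close> private neighbors that
has at most \<open>q\<close> neighbors on the other side.  By \<open>quadratic_discriminant_bound\<close> it forces
\<open>X / a + Y \<le> 0\<close>, where \<open>X\<close> is the positive term of \<open>constant_term_pos\<close> and \<open>Y\<close> the one of
\<open>constant_term_identity\<close>.
\<close>

lemma parameters_exclude_blocking_set:
  fixes a c N q j g :: real
  assumes "large_parameters a c N" and a: "a \<ge> 2" and q: "q \<ge> 1"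
    and j: "j = 0 \<or> j = 1 \<or> j = 2 \<or> j \<ge> 3" and Nq: "N = 2 * q + 1 + j"
    and c: "0 \<le> c" "c \<le> N"
    and ineq: "(N - c) * q / (q + 1) + (1 / a + 1 / N) * g\<^sup>2 + (1 / N + 1 / q) * (g + c)\<^sup>2 \<le> 4 * g + 2 * c"
  shows False
proof -
  have N: "N > 0" "N \<ge> 2 * q + 1" using j Nq q by auto
  define X where "X = (1 / N + 1 / q) * c\<^sup>2 - 2 * c + (N - c) * q / (q + 1)"
  define Y where "Y = (j - 3) / (q + 1) * (1 - c / N) + 2 * c * (1 + j) / (N * q) + c\<^sup>2 * (N + q) / (N\<^sup>2 * q)"
  have X: "X > 0" unfolding X_def using constant_term_pos[of q N c] q N by simp
  have "1 / a + 1 / N + (1 / N + 1 / q) > 0"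
    using a N q by (intro add_pos_pos) auto
  from quadratic_discriminant_bound[OF this ineq]
  have XY: "X / a + Y \<le> 0"
    using constant_term_identity[of q N j c] q N Nq unfolding X_def[symmetric] Y_def[symmetric]
    by (simp add: algebra_simps)
  show False
  proof (cases "j \<ge> 3")
    case True
    then have "Y \<ge> 0" unfolding Y_def using c N q by (intro add_nonneg_nonneg) auto
    moreover have "X / a > 0" using X a by simp
    ultimately show False using XY by linarith
  next
    case False
    then have j': "j = 0 \<or> j = 1 \<or> j = 2" using j by auto
    \<comment> \<open>For \<open>j \<le> 2\<close> the set is nearly half of \<open>N + 1\<close>, so the left-hand side is close to \<open>1 / 2 + 1\<close>.\<close>
    have w: "(q + 1) * (1 / N + 1 / q) \<ge> 3 / 2"
    proof -
      have "3 * (N * q) \<le> 2 * (q + 1) * (N + q)"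
        using j' q unfolding Nq by (auto simp: algebra_simps)
      then show ?thesis using N q by (simp add: field_simps)
    qed
    have "3 / 2 * c\<^sup>2 \<le> (q + 1) * (1 / N + 1 / q) * c\<^sup>2" using w by (intro mult_right_mono) auto
    also have "\<dots> = (q + 1) * X + 2 * c * (q + 1) - (N - c) * q"
    proof -
      have "(q + 1) * w * c\<^sup>2 = (q + 1) * (w * c\<^sup>2 - 2 * c + e) + 2 * c * (q + 1) - (q + 1) * e" for w e
        by (simp add: algebra_simps)
      from this[of "1 / N + 1 / q" "(N - c) * q / (q + 1)"] show ?thesis
        unfolding X_def using q by simp
    qed
    finally have X1: "(q + 1) * X \<ge> 3 / 2 * c\<^sup>2 - c * (3 * q + 2) + N * q"
      by (simp add: algebra_simps)
    have "N * ((q + 1) * Y) = (j - 3) * (N - c) + 2 * c * (1 + j) * ((q + 1) / q) + (q + 1) * (1 / N + 1 / q) * c\<^sup>2"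
      unfolding Y_def using q N by (simp add: divide_simps) (simp add: algebra_simps power2_eq_square)
    moreover have "2 * c * (1 + j) * ((q + 1) / q) \<ge> 2 * c * (1 + j) * 1"
      using c j' q by (intro mult_left_mono) auto
    moreover have "3 / 2 * c\<^sup>2 \<le> (q + 1) * (1 / N + 1 / q) * c\<^sup>2" using w by (intro mult_right_mono) auto
    ultimately have Y1: "N * ((q + 1) * Y) \<ge> (j - 3) * (N - c) + 2 * c * (1 + j) + 3 / 2 * c\<^sup>2"
      by linarith
    have "a * N * (q + 1) * (X / a + Y) \<le> 0" using XY a N q by (intro mult_nonneg_nonpos) auto
    also have "a * N * (q + 1) * (X / a + Y) = N * ((q + 1) * X) + a * (N * ((q + 1) * Y))"
      using a by (simp add: field_simps)
    finally have "N * ((q + 1) * X) + a * (N * ((q + 1) * Y)) \<le> 0" .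
    have "N * (3 * c\<^sup>2 - c * (3 * N + 1 - 3 * j) + N * (N - 1 - j))
        + a * ((2 * j - 6) * (N - c) + 4 * c * (1 + j) + 3 * c\<^sup>2)
      = 2 * (N * (3 / 2 * c\<^sup>2 - c * (3 * q + 2) + N * q) + a * ((j - 3) * (N - c) + 2 * c * (1 + j) + 3 / 2 * c\<^sup>2))"
      unfolding Nq by (simp add: algebra_simps)
    moreover have "N \<ge> 3 + j" using Nq q by simp
    note near_balanced_excess_pos[OF assms(1) a j' this]
    ultimately have "N * (3 / 2 * c\<^sup>2 - c * (3 * q + 2) + N * q)
        + a * ((j - 3) * (N - c) + 2 * c * (1 + j) + 3 / 2 * c\<^sup>2) > 0" (is "?U + ?V > 0")
      by simp
    moreover have "?U \<le> N * ((q + 1) * X)" using X1 N by (intro mult_left_mono) auto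
    moreover have "?V \<le> a * (N * ((q + 1) * Y))" using Y1 a by (intro mult_left_mono) auto
    ultimately show False
      using \<open>N * ((q + 1) * X) + a * (N * ((q + 1) * Y)) \<le> 0\<close> by linarith
  qed
qed

text \<open>
Division by the square of the size \<open>q + 1\<close> of the set, written in the variable \<open>g\<close>: if \<open>E\<close> counts
the edges from the set to the common neighbors, then \<open>g\<close> is the average number of common neighbors
that a member of the set misses.
\<close>

lemma normalised_square_sum_bound:
  fixes a b d q N E :: real
  defines "c \<equiv> b - a - 1" and "g \<equiv> a - E / (q + 1)"
  assumes "a > 0" "q > 0" "N > 0" "d = N + 1 + a"
    and ineq: "(q + 1)\<^sup>2 + ((q + 1) * (b - 1) - E)\<^sup>2 / q + ((q + 1) * a - E)\<^sup>2 / N + E\<^sup>2 / a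
      + ((q + 1) * (d - a - b) + E)\<^sup>2 / N \<le> (q + 1) * d + b * (q + 1) * q"
  shows "(N - c) * q / (q + 1) + (1 / a + 1 / N) * g\<^sup>2 + (1 / N + 1 / q) * (g + c)\<^sup>2 \<le> 4 * g + 2 * c"
proof -
  have E: "E = (q + 1) * (a - g)" using assms by (simp add: g_def)
  have b: "b = a + 1 + c" by (simp add: c_def)
  have sq: "(q + 1) * (b - 1) - E = (q + 1) * (g + c)" "(q + 1) * a - E = (q + 1) * g"
    "(q + 1) * (d - a - b) + E = (q + 1) * (N - (g + c))"
    unfolding E b \<open>d = _\<close> by (simp_all add: algebra_simps)
  let ?S = "1 + (g + c)\<^sup>2 / q + g\<^sup>2 / N + (a - g)\<^sup>2 / a + (N - (g + c))\<^sup>2 / N"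
  have "Q\<^sup>2 + (Q * u1)\<^sup>2 / q + (Q * u2)\<^sup>2 / N + (Q * u3)\<^sup>2 / a + (Q * u4)\<^sup>2 / N
      = Q * (Q * (1 + u1\<^sup>2 / q + u2\<^sup>2 / N + u3\<^sup>2 / a + u4\<^sup>2 / N))" for Q u1 u2 u3 u4
    by (simp add: power_mult_distrib distrib_left power2_eq_square[of Q])
  from this[of "q + 1" "g + c" g "a - g" "N - (g + c)"] have "(q + 1) * ((q + 1) * ?S) \<le> (q + 1) * d + b * (q + 1) * q"
    using ineq unfolding sq unfolding E by simp
  also have "\<dots> = (q + 1) * ((N - c) + (q + 1) * (a + 1 + c))"
    unfolding b \<open>d = _\<close> by (simp add: algebra_simps)
  finally have "(q + 1) * ((q + 1) * ?S) \<le> (q + 1) * ((N - c) + (q + 1) * (a + 1 + c))" .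
  then have "(q + 1) * ?S \<le> (N - c) + (q + 1) * (a + 1 + c)" using \<open>q > 0\<close> by simp
  then have "?S \<le> (N - c) / (q + 1) + (a + 1 + c)" using \<open>q > 0\<close> by (simp add: field_simps)
  moreover have "(a - g)\<^sup>2 / a = a - 2 * g + g\<^sup>2 / a"
    using \<open>a > 0\<close> by (simp add: field_simps power2_eq_square)
  moreover have "(N - (g + c))\<^sup>2 / N = N - 2 * (g + c) + (g + c)\<^sup>2 / N"
    using \<open>N > 0\<close> by (simp add: field_simps power2_eq_square)
  moreover have "(N - c) * q / (q + 1) = (N - c) - (N - c) / (q + 1)"
    using \<open>q > 0\<close> by (simp add: field_simps)
  ultimately show ?thesis by (simp add: algebra_simps)
qed

section \<open>Conditions on the parameters\<close>

text \<open>
The parameters for which a blocking set can be excluded.  For \<open>\<alpha> \<le> 1\<close> the bipartite graph between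
the private neighbors is regular, and the polynomial condition is replaced by \<open>2 \<le> \<beta>\<close>; without
\<open>d \<noteq> 2\<close> the first alternative would admit the pentagon, in which the private neighbors of \<open>x\<close> and
\<open>y\<close> are one vertex each and not adjacent.
\<close>

definition admissible_parameters :: "nat \<Rightarrow> nat \<Rightarrow> nat \<Rightarrow> bool" where
  "admissible_parameters d \<alpha> \<beta> \<longleftrightarrow> \<alpha> < \<beta> \<and>
    (\<alpha> = 0 \<and> \<beta> = 1 \<and> d \<noteq> 2 \<or> \<alpha> \<le> 1 \<and> 2 \<le> \<beta> \<or>
     2 \<le> \<alpha> \<and> large_parameters (real \<alpha>) (real \<beta> - real \<alpha> - 1) (real d - real \<alpha> - 1))"

lemma admissible_parameters_if_degree_large:
  assumes "\<beta> = \<alpha> + 1" "real d > real \<alpha> + sqrt (6 * real \<alpha> + 1 / 4) + 3 / 2"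
  shows "admissible_parameters d \<alpha> \<beta>"
proof -
  define N where "N = real d - real \<alpha> - 1"
  have N: "N - 1 / 2 > sqrt (6 * real \<alpha> + 1 / 4)" using assms(2) by (simp add: N_def)
  then have "(N - 1 / 2)\<^sup>2 > (sqrt (6 * real \<alpha> + 1 / 4))\<^sup>2" by (intro power_strict_mono) auto
  then have NN: "N * (N - 1) > 6 * real \<alpha>" by (simp add: power2_eq_square algebra_simps)
  have "d \<noteq> 2" if "\<alpha> = 0"
  proof
    assume "d = 2"
    then have "N = 1" using that by (simp add: N_def)
    then show False using NN by simp
  qed
  moreover have "large_parameters (real \<alpha>) (real \<beta> - real \<alpha> - 1) N"
    using NN assms(1) by (simp add: large_parameters_def)
  ultimately show ?thesis
    using assms(1) unfolding admissible_parameters_def N_def[symmetric]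
    by (cases "\<alpha> = 0"; cases "\<alpha> = 1") auto
qed

text \<open>
The second hypothesis says that \<open>d\<close> does not lie strictly between the roots of
\<open>d\<^sup>2 - 3 * d * \<beta> + 3 * \<beta>\<^sup>2 - 7 * \<beta> - \<alpha>\<^sup>2\<close>.
\<close>

lemma admissible_parameters_if_discriminant_small:
  assumes "\<beta> \<ge> \<alpha> + 2"
    and "4 * (real \<alpha>)\<^sup>2 - 3 * (real \<beta>)\<^sup>2 + 28 * real \<beta> \<le> (2 * real d - 3 * real \<beta>)\<^sup>2"
  shows "admissible_parameters d \<alpha> \<beta>"
proof -
  define N c where "N = real d - real \<alpha> - 1" and "c = real \<beta> - real \<alpha> - 1"
  have eq: "4 * (N\<^sup>2 - 3 * c * N + 3 * c\<^sup>2 - N - 4 * c - 6 - real \<alpha> * (N - 3 * c + 5))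
      = (2 * real d - 3 * real \<beta>)\<^sup>2 - (4 * (real \<alpha>)\<^sup>2 - 3 * (real \<beta>)\<^sup>2 + 28 * real \<beta>)"
    unfolding N_def c_def by (simp add: power2_eq_square algebra_simps)
  have "4 * (N\<^sup>2 - 3 * c * N + 3 * c\<^sup>2 - N - 4 * c - 6 - real \<alpha> * (N - 3 * c + 5)) \<ge> 0"
    unfolding eq using assms(2) by (rule iffD2[OF diff_ge_0_iff_ge])
  then have "N\<^sup>2 - 3 * c * N + 3 * c\<^sup>2 - N - 4 * c - 6 - real \<alpha> * (N - 3 * c + 5) \<ge> 0"
    by (simp only: zero_le_mult_iff) simp
  moreover have "c \<ge> 1" using assms(1) unfolding c_def by linarith
  ultimately have "large_parameters (real \<alpha>) c N" by (simp add: large_parameters_def)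
  then show ?thesis
    using assms(1) unfolding admissible_parameters_def N_def[symmetric] c_def[symmetric]
    by (cases "\<alpha> \<le> 1") auto
qed

text \<open>
For \<open>\<alpha> \<ge> 2\<close> the polynomial \<open>d\<^sup>2 - 3 * d * \<beta> + 3 * \<beta>\<^sup>2 - 7 * \<beta> - \<alpha>\<^sup>2\<close> in \<open>d\<close> has nonpositive
discriminant, so that \<open>d\<close> is arbitrary.
\<close>

lemma admissible_parameters_if_beta_large:
  assumes \<beta>: "real \<beta> \<ge> 2 * sqrt 3 / 3 * real \<alpha> + 7"
  shows "admissible_parameters d \<alpha> \<beta>"
proof -
  define r where "r = 2 * sqrt 3 / 3"
  have r2: "r\<^sup>2 = 4 / 3" by (simp add: r_def power_divide power_mult_distrib)
  have r: "r \<ge> 23 / 20" "r \<ge> 0"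
    using real_le_rsqrt[of "69 / 40" 3] by (simp_all add: r_def power2_eq_square)
  have b: "real \<beta> \<ge> r * real \<alpha> + 7" using \<beta> by (simp add: r_def)
  have ra: "r * real \<alpha> \<ge> 23 / 20 * real \<alpha>" using r by (intro mult_right_mono) auto
  have \<alpha>\<beta>: "\<beta> \<ge> \<alpha> + 7" using b ra by linarith
  show ?thesis
  proof (cases "\<alpha> \<le> 1")
    case True
    then show ?thesis using \<alpha>\<beta> by (simp add: admissible_parameters_def)
  next
    case False
    have "4 * (real \<alpha>)\<^sup>2 - 3 * (real \<beta>)\<^sup>2 + 28 * real \<beta> \<le> 0"
    proof (cases "\<alpha> \<ge> 4")
      case True
      have "(real \<beta> - 14 / 3)\<^sup>2 \<ge> (r * real \<alpha> + 7 / 3)\<^sup>2"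
        using b r by (intro power_mono) auto
      also have "(r * real \<alpha> + 7 / 3)\<^sup>2 = r\<^sup>2 * (real \<alpha>)\<^sup>2 + 14 / 3 * (r * real \<alpha>) + 49 / 9"
        by (simp add: power2_eq_square algebra_simps)
      finally have "(real \<beta> - 14 / 3)\<^sup>2 \<ge> 4 / 3 * (real \<alpha>)\<^sup>2 + 14 / 3 * (r * real \<alpha>) + 49 / 9"
        unfolding r2 by simp
      moreover have "r * real \<alpha> \<ge> 23 / 5" using ra True by linarith
      moreover have "(real \<beta> - 14 / 3)\<^sup>2 = (real \<beta>)\<^sup>2 - 28 / 3 * real \<beta> + 196 / 9"
        by (simp add: power2_eq_square algebra_simps)
      ultimately show ?thesis by linarith
    next
      case small: False
      \<comment> \<open>The real estimate is too weak for \<open>\<alpha> \<in> {2, 3}\<close>; rounding \<open>\<beta>\<close> up to an integer repairs it.\<close>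
      have "\<beta> \<ge> 8 + \<alpha>" using b ra False by linarith
      then have "real \<beta> * (3 * real \<beta> - 28) \<ge> (8 + real \<alpha>) * (3 * (8 + real \<alpha>) - 28)"
        using False by (intro mult_mono) auto
      moreover have "\<alpha> = 2 \<or> \<alpha> = 3" using False small by linarith
      ultimately show ?thesis by (auto simp: power2_eq_square algebra_simps)
    qed
    also have "0 \<le> (2 * real d - 3 * real \<beta>)\<^sup>2" by simp
    finally show ?thesis using \<alpha>\<beta> by (intro admissible_parameters_if_discriminant_small) auto
  qed
qed

section \<open>Hall's marriage theorem\<close>

text \<open>
Hall's theorem, by the argument of Halmos and Vaughan: if some nonempty proper subset \<open>X\<close> of \<open>A\<close> is
tight, match \<open>X\<close> and the rest separately, since removing the neighbors of \<open>X\<close> costs exactly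
\<open>card X\<close>; otherwise every such subset has a neighbor to spare, so one pair may be chosen freely.
\<close>

lemma hall_marriage:
  assumes "finite A" "\<And>a. a \<in> A \<Longrightarrow> finite (F a)"
    and "\<And>X. X \<subseteq> A \<Longrightarrow> card X \<le> card (\<Union> (F ` X))"
  shows "\<exists>f. inj_on f A \<and> (\<forall>a\<in>A. f a \<in> F a)"
  using assms
proof (induction "card A" arbitrary: A F rule: less_induct)
  case less
  note fin = less.prems(1) and finF = less.prems(2) and hall = less.prems(3)
  have finU: "finite (\<Union> (F ` X))" if "X \<subseteq> A" for X
    using that fin finF by (auto intro: finite_subset)
  show ?case
  proof (cases "\<exists>X. X \<noteq> {} \<and> X \<subset> A \<and> card (\<Union> (F ` X)) \<le> card X")
    case True
    then obtain X where X: "X \<noteq> {}" "X \<subset> A" "card (\<Union> (F ` X)) \<le> card X" by blast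
    have finX: "finite X" using X fin by (auto intro: finite_subset)
    have "\<exists>f. inj_on f X \<and> (\<forall>a\<in>X. f a \<in> F a)"
      using X by (intro less.hyps psubset_card_mono fin finX finF hall) auto
    then obtain f where f: "inj_on f X" "\<And>a. a \<in> X \<Longrightarrow> f a \<in> F a" by blast
    have "\<exists>g. inj_on g (A - X) \<and> (\<forall>a\<in>A - X. g a \<in> F a - \<Union> (F ` X))"
    proof (intro less.hyps)
      show "card (A - X) < card A" using X fin by (intro psubset_card_mono) auto
      show "card Y \<le> card (\<Union> ((\<lambda>a. F a - \<Union> (F ` X)) ` Y))" if Y: "Y \<subseteq> A - X" for Y
      proof -
        have "finite Y" using Y fin by (auto intro: finite_subset)
        then have "card X + card Y = card (X \<union> Y)" using Y finX by (subst card_Un_disjoint) auto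
        also have "\<dots> \<le> card (\<Union> (F ` (X \<union> Y)))" using X Y by (intro hall) auto
        also have "\<Union> (F ` (X \<union> Y)) = \<Union> (F ` X) \<union> \<Union> ((\<lambda>a. F a - \<Union> (F ` X)) ` Y)" by auto
        also have "card \<dots> \<le> card (\<Union> (F ` X)) + card (\<Union> ((\<lambda>a. F a - \<Union> (F ` X)) ` Y))"
          by (rule card_Un_le)
        finally show ?thesis using X(3) by simp
      qed
    qed (use fin finF in auto)
    then obtain g where g: "inj_on g (A - X)" "\<And>a. a \<in> A - X \<Longrightarrow> g a \<in> F a - \<Union> (F ` X)" by blast
    have "inj_on (\<lambda>a. if a \<in> X then f a else g a) A"
    proof (rule inj_onI)
      fix a b assume "a \<in> A" "b \<in> A" "(if a \<in> X then f a else g a) = (if b \<in> X then f b else g b)"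
      then show "a = b"
        using f g by (cases "a \<in> X"; cases "b \<in> X") (auto dest: inj_onD, metis+)
    qed
    moreover have "\<forall>a\<in>A. (if a \<in> X then f a else g a) \<in> F a" using f g by auto
    ultimately show ?thesis by blast
  next
    case False
    show ?thesis
    proof (cases "A = {}")
      case False
      then obtain a where a: "a \<in> A" by blast
      have "F a \<noteq> {}" using hall[of "{a}"] a by auto
      then obtain b where b: "b \<in> F a" by blast
      have "\<exists>f. inj_on f (A - {a}) \<and> (\<forall>u\<in>A - {a}. f u \<in> F u - {b})"
      proof (intro less.hyps)
        show "card (A - {a}) < card A" using a fin by (intro psubset_card_mono) auto
        show "card Y \<le> card (\<Union> ((\<lambda>u. F u - {b}) ` Y))" if Y: "Y \<subseteq> A - {a}" for Y
        proof (cases "Y = {}")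
          case False
          then have "card Y < card (\<Union> (F ` Y))"
            using Y a \<open>\<not> (\<exists>X. X \<noteq> {} \<and> X \<subset> A \<and> card (\<Union> (F ` X)) \<le> card X)\<close>
            by (metis Diff_insert_absorb linorder_not_le mk_disjoint_insert psubsetI subset_Diff_insert subset_insertI2)
          moreover have "\<Union> ((\<lambda>u. F u - {b}) ` Y) = \<Union> (F ` Y) - {b}" by auto
          moreover have "card (\<Union> (F ` Y)) - 1 \<le> card (\<Union> (F ` Y) - {b})"
            by (simp add: card_Diff_singleton_if)
          ultimately show ?thesis by simp
        qed simp
      qed (use fin finF in auto)
      then obtain f where f: "inj_on f (A - {a})" "\<And>u. u \<in> A - {a} \<Longrightarrow> f u \<in> F u - {b}" by blast
      have "inj_on (f(a := b)) A"
        using f by (auto simp: inj_on_def)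
      moreover have "\<forall>u\<in>A. (f(a := b)) u \<in> F u" using f b by auto
      ultimately show ?thesis by blast
    qed simp
  qed
qed

section \<open>Neighborhoods along an edge\<close>

context amply_regular begin

lemma neighbors_iff: "v \<in> \<Gamma> u \<longleftrightarrow> u \<rightarrow> v"
  by (auto simp: neighbors_def dest: adj_in_verts)

lemma neighbors_sym: "v \<in> \<Gamma> u \<longleftrightarrow> u \<in> \<Gamma> v"
  unfolding neighbors_iff using arcs_ends_symmetric[OF sym_arcs] by blast

lemma self_notin_neighbors [simp]: "u \<notin> \<Gamma> u"
  unfolding neighbors_iff using adj_not_same by blast

lemma neighbors_subset: "\<Gamma> u \<subseteq> verts G"
  by (auto simp: neighbors_def)

lemma finite_neighbors [simp]: "finite (\<Gamma> u)"
  using neighbors_subset finite_verts by (rule finite_subset)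

lemma neighbors_in_verts: "v \<in> \<Gamma> u \<Longrightarrow> u \<in> verts G" "v \<in> \<Gamma> u \<Longrightarrow> v \<in> verts G"
  unfolding neighbors_iff using adj_in_verts by blast+

lemma card_neighbors: "v \<in> \<Gamma> u \<Longrightarrow> card (\<Gamma> v) = d" "v \<in> \<Gamma> u \<Longrightarrow> card (\<Gamma> u) = d"
  using regular neighbors_in_verts by blast+

lemma codegree_adjacent: "v \<in> \<Gamma> u \<Longrightarrow> card (\<Gamma> u \<inter> \<Gamma> v) = \<alpha>"
  using common_adjacent neighbors_in_verts unfolding neighbors_iff by blast

lemma codegree_nonadjacent:
  assumes "u \<noteq> v" "v \<notin> \<Gamma> u" "w \<in> \<Gamma> u" "w \<in> \<Gamma> v"
  shows "card (\<Gamma> u \<inter> \<Gamma> v) = \<beta>"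
proof (rule common_dist2)
  show uv: "u \<in> verts G" "v \<in> verts G" using assms neighbors_in_verts by blast+
  show "\<mu> (\<lambda>_. 1) u v = 2"
    unfolding dist_eq_2_iff[OF uv] using assms by (auto simp: neighbors_iff)
qed

lemma card_neighbors_inter_as_sum:
  assumes "finite T"
  shows "card (\<Gamma> w \<inter> T) = (\<Sum>t\<in>T. of_bool (t \<in> \<Gamma> w))"
proof -
  have "T \<inter> {t. t \<in> \<Gamma> w} = \<Gamma> w \<inter> T" by auto
  then show ?thesis using assms by simp
qed

lemma sum_card_neighbors_swap:
  assumes "finite T" "finite W"
  shows "(\<Sum>w\<in>W. card (\<Gamma> w \<inter> T)) = (\<Sum>t\<in>T. card (\<Gamma> t \<inter> W))"
proof -
  have "(\<Sum>w\<in>W. card (\<Gamma> w \<inter> T)) = (\<Sum>w\<in>W. \<Sum>t\<in>T. of_bool (t \<in> \<Gamma> w))"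
    by (simp only: card_neighbors_inter_as_sum[OF assms(1)])
  also have "\<dots> = (\<Sum>t\<in>T. \<Sum>w\<in>W. of_bool (w \<in> \<Gamma> t))"
    by (subst sum.swap) (simp only: neighbors_sym)
  also have "\<dots> = (\<Sum>t\<in>T. card (\<Gamma> t \<inter> W))"
    by (simp only: card_neighbors_inter_as_sum[OF assms(2)])
  finally show ?thesis .
qed

text \<open>
Both sides count the triples of two members of \<open>T\<close> and a common neighbor \<open>w\<close> of them.
\<close>

lemma sum_squares_eq_sum_codegrees:
  assumes "finite T"
  shows "(\<Sum>w\<in>verts G. (card (\<Gamma> w \<inter> T))\<^sup>2) = (\<Sum>t\<in>T. \<Sum>t'\<in>T. card (\<Gamma> t \<inter> \<Gamma> t'))"
proof -
  have c: "card (\<Gamma> t \<inter> \<Gamma> t') = (\<Sum>w\<in>verts G. of_bool (t \<in> \<Gamma> w) * of_bool (t' \<in> \<Gamma> w))" for t t'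
  proof -
    have "(\<Sum>w\<in>verts G. of_bool (t \<in> \<Gamma> w) * of_bool (t' \<in> \<Gamma> w))
        = (\<Sum>w\<in>verts G. of_bool (w \<in> \<Gamma> t \<inter> \<Gamma> t') :: nat)"
      by (intro sum.cong refl) (auto simp: neighbors_sym)
    also have "\<dots> = card (verts G \<inter> {w. w \<in> \<Gamma> t \<inter> \<Gamma> t'})" by simp
    also have "verts G \<inter> {w. w \<in> \<Gamma> t \<inter> \<Gamma> t'} = \<Gamma> t \<inter> \<Gamma> t'" using neighbors_subset by blast
    finally show ?thesis by simp
  qed
  have "(\<Sum>w\<in>verts G. (card (\<Gamma> w \<inter> T))\<^sup>2)
      = (\<Sum>w\<in>verts G. \<Sum>t\<in>T. \<Sum>t'\<in>T. of_bool (t \<in> \<Gamma> w) * of_bool (t' \<in> \<Gamma> w))"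
    by (simp only: card_neighbors_inter_as_sum[OF assms] power2_eq_square sum_product)
  also have "\<dots> = (\<Sum>t\<in>T. \<Sum>w\<in>verts G. \<Sum>t'\<in>T. of_bool (t \<in> \<Gamma> w) * of_bool (t' \<in> \<Gamma> w))"
    by (rule sum.swap)
  also have "\<dots> = (\<Sum>t\<in>T. \<Sum>t'\<in>T. \<Sum>w\<in>verts G. of_bool (t \<in> \<Gamma> w) * of_bool (t' \<in> \<Gamma> w))"
    by (intro sum.cong refl sum.swap)
  finally show ?thesis by (simp only: c)
qed

end

text \<open>
An edge \<open>xy\<close> splits the vertex set into \<open>x\<close>, \<open>y\<close>, the common neighbors \<open>D\<close>, the private neighbors
\<open>Nx\<close> and \<open>Ny\<close>, and the vertices \<open>Z\<close> adjacent to neither end.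
\<close>

locale amply_regular_edge = amply_regular +
  fixes x y
  assumes edge: "x \<rightarrow> y"
    and few_vertices: "n + 2 * \<alpha> < 3 * d"
begin

abbreviation "D \<equiv> common_neighbors G x y"
abbreviation "Nx \<equiv> private_neighbors G x y"
abbreviation "Ny \<equiv> private_neighbors G y x"
abbreviation "Z \<equiv> verts G - (\<Gamma> x \<union> \<Gamma> y)"

lemma xy: "y \<in> \<Gamma> x" "x \<in> \<Gamma> y" "x \<noteq> y"
  using edge neighbors_iff neighbors_sym self_notin_neighbors by blast+

lemma finite_parts [simp]: "finite D" "finite Nx" "finite Ny" "finite Z"
  by (auto simp: common_neighbors_def private_neighbors_def)

lemma neighbors_x: "\<Gamma> x = {y} \<union> D \<union> Nx" and neighbors_y: "\<Gamma> y = {x} \<union> D \<union> Ny"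
  using xy by (auto simp: common_neighbors_def private_neighbors_def)

lemma verts_eq: "verts G = {x} \<union> {y} \<union> D \<union> Nx \<union> Ny \<union> Z"
  using neighbors_subset[of x] neighbors_subset[of y] xy
  by (auto simp: common_neighbors_def private_neighbors_def)

lemma parts_disjoint:
  "x \<notin> D" "y \<notin> D" "x \<notin> Nx" "y \<notin> Nx" "x \<notin> Ny" "y \<notin> Ny" "x \<notin> Z" "y \<notin> Z"
  "D \<inter> Nx = {}" "D \<inter> Ny = {}" "D \<inter> Z = {}" "Nx \<inter> Ny = {}" "Nx \<inter> Z = {}" "Ny \<inter> Z = {}"
  using xy by (auto simp: common_neighbors_def private_neighbors_def)

lemma card_inter_neighbors_x:
  "finite A \<Longrightarrow> card (A \<inter> \<Gamma> x) = card (A \<inter> {y}) + card (A \<inter> D) + card (A \<inter> Nx)"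
  unfolding neighbors_x Int_Un_distrib using parts_disjoint
  by (subst card_Un_disjoint; auto)+

lemma card_inter_neighbors_y:
  "finite A \<Longrightarrow> card (A \<inter> \<Gamma> y) = card (A \<inter> {x}) + card (A \<inter> D) + card (A \<inter> Ny)"
  unfolding neighbors_y Int_Un_distrib using parts_disjoint
  by (subst card_Un_disjoint; auto)+

lemma card_split:
  assumes "A \<subseteq> verts G"
  shows "card A = card (A \<inter> {x}) + card (A \<inter> {y}) + card (A \<inter> D) + card (A \<inter> Nx) + card (A \<inter> Ny) + card (A \<inter> Z)"
proof -
  have fin: "finite A" using assms finite_verts finite_subset by blast
  have "A = A \<inter> \<Gamma> x \<union> (A \<inter> {x} \<union> A \<inter> Ny) \<union> A \<inter> Z"
    using subset_trans[OF assms equalityD1[OF verts_eq]] unfolding neighbors_x by blast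
  then have "card A = card (A \<inter> \<Gamma> x \<union> (A \<inter> {x} \<union> A \<inter> Ny) \<union> A \<inter> Z)" by simp
  also have "\<dots> = card (A \<inter> \<Gamma> x) + (card (A \<inter> {x}) + card (A \<inter> Ny)) + card (A \<inter> Z)"
  proof -
    have "card (A \<inter> \<Gamma> x \<union> (A \<inter> {x} \<union> A \<inter> Ny) \<union> A \<inter> Z) = card (A \<inter> \<Gamma> x \<union> (A \<inter> {x} \<union> A \<inter> Ny)) + card (A \<inter> Z)"
      using fin parts_disjoint xy by (intro card_Un_disjoint) auto
    moreover have "card (A \<inter> \<Gamma> x \<union> (A \<inter> {x} \<union> A \<inter> Ny)) = card (A \<inter> \<Gamma> x) + card (A \<inter> {x} \<union> A \<inter> Ny)"
      using fin parts_disjoint xy unfolding neighbors_x by (intro card_Un_disjoint) auto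
    moreover have "card (A \<inter> {x} \<union> A \<inter> Ny) = card (A \<inter> {x}) + card (A \<inter> Ny)"
      using fin parts_disjoint by (intro card_Un_disjoint) auto
    ultimately show ?thesis by simp
  qed
  finally show ?thesis using card_inter_neighbors_x[OF fin] by simp
qed

lemma card_D: "card D = \<alpha>"
  unfolding common_neighbors_def using codegree_adjacent xy by blast

lemma card_Nx: "card Nx + \<alpha> + 1 = d"
  using card_inter_neighbors_x[of "\<Gamma> x"] card_D card_neighbors(2)[OF xy(1)] xy
  by (simp add: neighbors_x Int_absorb2 Int_absorb1 parts_disjoint Int_Un_distrib2)

lemma card_Ny: "card Ny + \<alpha> + 1 = d"
  using card_inter_neighbors_y[of "\<Gamma> y"] card_D card_neighbors(1)[OF xy(1)] xy
  by (simp add: neighbors_y Int_absorb2 Int_absorb1 parts_disjoint Int_Un_distrib2)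

text \<open>
This is how the bound on the number of vertices enters: \<open>Z\<close> is no larger than \<open>Nx\<close> and \<open>Ny\<close>.
\<close>

lemma card_Z: "card Z + \<alpha> + 1 \<le> d"
proof -
  have "D \<subseteq> verts G" "Nx \<subseteq> verts G" "Ny \<subseteq> verts G" "Z \<subseteq> verts G"
    using equalityD2[OF verts_eq] by simp_all
  then have "n = 2 + card D + card Nx + card Ny + card Z"
    using card_split[OF subset_refl] num_verts xy neighbors_in_verts[OF xy(1)]
    by (simp add: Int_absorb1)
  then show ?thesis using card_D card_Nx card_Ny few_vertices by linarith
qed

lemma Ny_adjacency:
  assumes "t \<in> Ny"
  shows "t \<in> \<Gamma> y" "t \<notin> \<Gamma> x" "t \<noteq> x" "t \<noteq> y" "x \<notin> \<Gamma> t" "y \<in> \<Gamma> t"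
  using assms xy neighbors_sym by (auto simp: common_neighbors_def private_neighbors_def)

text \<open>
A vertex \<open>t\<close> of \<open>Ny\<close> is adjacent to \<open>y\<close> and at distance two from \<open>x\<close>, so all its degrees into the
parts are determined by the number of its neighbors in \<open>D\<close>.
\<close>

lemma Ny_degrees:
  assumes t: "t \<in> Ny"
  shows "card (\<Gamma> t \<inter> Nx) + card (\<Gamma> t \<inter> D) + 1 = \<beta>"
    and "card (\<Gamma> t \<inter> Ny) + card (\<Gamma> t \<inter> D) = \<alpha>"
    and "card (\<Gamma> t \<inter> Z) + \<alpha> + \<beta> = d + card (\<Gamma> t \<inter> D)"
    and "\<beta> \<le> d"
proof -
  note tD = Ny_adjacency[OF t]
  have x: "card (\<Gamma> t \<inter> \<Gamma> x) = \<beta>"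
    using tD xy neighbors_sym by (intro codegree_nonadjacent[of _ _ y]) auto
  have y: "card (\<Gamma> t \<inter> \<Gamma> y) = \<alpha>"
    using codegree_adjacent[OF tD(1)] by (simp add: Int_commute)
  show 1: "card (\<Gamma> t \<inter> Nx) + card (\<Gamma> t \<inter> D) + 1 = \<beta>"
    using card_inter_neighbors_x[of "\<Gamma> t"] x tD by simp
  show 2: "card (\<Gamma> t \<inter> Ny) + card (\<Gamma> t \<inter> D) = \<alpha>"
    using card_inter_neighbors_y[of "\<Gamma> t"] y tD by simp
  show "card (\<Gamma> t \<inter> Z) + \<alpha> + \<beta> = d + card (\<Gamma> t \<inter> D)"
    using card_split[OF neighbors_subset[of t]] 1 2 card_neighbors(1)[OF tD(1)] tD by simp
  show "\<beta> \<le> d" using x card_neighbors(2)[OF xy(1)] card_mono[of "\<Gamma> x" "\<Gamma> t \<inter> \<Gamma> x"] by simp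
qed

lemma swap_edge: "amply_regular_edge G n d \<alpha> \<beta> y x"
  using edge arcs_ends_symmetric[OF sym_arcs] few_vertices
  by unfold_locales auto


lemma Nx_adjacency:
  assumes "s \<in> Nx"
  shows "s \<in> \<Gamma> x" "s \<notin> \<Gamma> y" "s \<noteq> x" "s \<noteq> y" "y \<notin> \<Gamma> s" "x \<in> \<Gamma> s"
  using assms xy neighbors_sym by (auto simp: common_neighbors_def private_neighbors_def)

lemma Nx_degrees:
  assumes s: "s \<in> Nx"
  shows "card (\<Gamma> s \<inter> Ny) + card (\<Gamma> s \<inter> D) + 1 = \<beta>"
    and "card (\<Gamma> s \<inter> Nx) + card (\<Gamma> s \<inter> D) = \<alpha>"
    and "card (\<Gamma> s \<inter> Z) + \<alpha> + \<beta> = d + card (\<Gamma> s \<inter> D)"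
proof -
  interpret swap: amply_regular_edge G n d \<alpha> \<beta> y x by (rule swap_edge)
  have "common_neighbors G y x = D" "\<Gamma> y \<union> \<Gamma> x = \<Gamma> x \<union> \<Gamma> y"
    by (auto simp: common_neighbors_def)
  then show "card (\<Gamma> s \<inter> Ny) + card (\<Gamma> s \<inter> D) + 1 = \<beta>"
    "card (\<Gamma> s \<inter> Nx) + card (\<Gamma> s \<inter> D) = \<alpha>"
    "card (\<Gamma> s \<inter> Z) + \<alpha> + \<beta> = d + card (\<Gamma> s \<inter> D)"
    using swap.Ny_degrees[OF s] by simp_all
qed

text \<open>
A parity argument.  If \<open>t\<close> has no neighbor in \<open>Nx\<close>, counting forces \<open>\<beta> = \<alpha> + 1\<close> and that \<open>t\<close> is
adjacent to all of \<open>D\<close> and \<open>Z\<close>, so the neighborhoods of \<open>x\<close>, \<open>y\<close> and \<open>t\<close> cover the graph and meet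
pairwise in little more than \<open>D\<close>.  Inclusion-exclusion for the degree of a vertex of \<open>D\<close> shows that
\<open>d + \<alpha>\<close> is odd, and for a vertex of \<open>Nx\<close> that \<open>d + \<alpha>\<close> is even; hence \<open>D\<close> is empty.
\<close>

lemma isolated_private_neighbor:
  assumes t: "t \<in> Ny" and iso: "\<Gamma> t \<inter> Nx = {}" and "\<alpha> < \<beta>"
  shows "\<beta> = \<alpha> + 1 \<and> \<alpha> = 0 \<and> d = 2"
proof -
  note tD = Ny_adjacency[OF t] and deg = Ny_degrees[OF t]
  have "a = \<alpha> \<and> \<beta> = \<alpha> + 1 \<and> b = 0" if "a + 1 = \<beta>" "b + a = \<alpha>" for a b
    using that \<open>\<alpha> < \<beta>\<close> by auto
  from this[OF _ deg(2)] deg(1) iso have e: "card (\<Gamma> t \<inter> D) = \<alpha>" and \<beta>: "\<beta> = \<alpha> + 1"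
    and Ny0: "card (\<Gamma> t \<inter> Ny) = 0"
    by simp_all
  have D: "\<Gamma> t \<inter> D = D" by (rule card_seteq) (simp_all add: e card_D)
  have "card (\<Gamma> t \<inter> Z) \<ge> card Z" using deg e \<beta> card_Z by linarith
  then have Z: "\<Gamma> t \<inter> Z = Z" by (intro card_seteq) simp_all
  have \<Gamma>t: "\<Gamma> t = {y} \<union> D \<union> Z"
  proof -
    have Ny: "\<Gamma> t \<inter> Ny = {}" using Ny0 by simp
    have "\<Gamma> t \<subseteq> {x} \<union> {y} \<union> D \<union> Nx \<union> Ny \<union> Z"
      using subset_trans[OF neighbors_subset equalityD1[OF verts_eq]] .
    then have "\<Gamma> t \<subseteq> {y} \<union> D \<union> Z" using Ny iso tD(5) by blast
    moreover have "{y} \<union> D \<union> Z \<subseteq> \<Gamma> t" using D Z tD(6) by blast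
    ultimately show ?thesis by (rule equalityI)
  qed
  have inter_t: "card (A \<inter> \<Gamma> t) = card (A \<inter> {y}) + card (A \<inter> D) + card (A \<inter> Z)" if "finite A" for A
    unfolding \<Gamma>t Int_Un_distrib using parts_disjoint that
    by (subst card_Un_disjoint; auto)+
  have odd_d: "odd (d + \<alpha>)" if "z \<in> D" for z
  proof -
    have z: "z \<in> \<Gamma> x" "z \<in> \<Gamma> y" "z \<in> \<Gamma> t" "x \<in> \<Gamma> z" "y \<in> \<Gamma> z"
      using that D neighbors_sym by (auto simp: common_neighbors_def)
    have "card (\<Gamma> z \<inter> \<Gamma> x) = \<alpha>" "card (\<Gamma> z \<inter> \<Gamma> y) = \<alpha>" "card (\<Gamma> z \<inter> \<Gamma> t) = \<alpha>"
      using z codegree_adjacent by (simp_all only: Int_commute[of "\<Gamma> z"])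
    moreover have "card (\<Gamma> z) = d" using card_neighbors(1)[OF z(1)] .
    ultimately have "3 * \<alpha> = d + 2 * card (\<Gamma> z \<inter> D) + 1"
      using card_split[OF neighbors_subset[of z]] card_inter_neighbors_x[of "\<Gamma> z"]
        card_inter_neighbors_y[of "\<Gamma> z"] inter_t[of "\<Gamma> z"] z by simp
    then show ?thesis by presburger
  qed
  have "card Nx = card Ny" using card_Nx card_Ny by simp
  moreover have "card Ny > 0" using t by (auto simp: card_gt_0_iff)
  ultimately obtain s where s: "s \<in> Nx" by (metis card_gt_0_iff all_not_in_conv)
  note sD = Nx_adjacency[OF s] and sdeg = Nx_degrees[OF s]
  have st: "s \<noteq> t" "s \<notin> \<Gamma> t" using s t iso parts_disjoint by auto
  have d: "d + card (\<Gamma> s \<inter> D) = \<alpha> + \<beta> + card (\<Gamma> s \<inter> Z)" using sdeg(3) by simp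
  have c: "card (\<Gamma> s \<inter> \<Gamma> t) = card (\<Gamma> s \<inter> D) + card (\<Gamma> s \<inter> Z)"
    using inter_t[of "\<Gamma> s"] sD by simp
  \<comment> \<open>Otherwise \<open>s\<close> has all its \<open>\<alpha>\<close> common neighbors with \<open>x\<close> in \<open>Nx - {s}\<close>, which has \<open>\<alpha> - 1\<close> members.\<close>
  have "\<Gamma> s \<inter> \<Gamma> t \<noteq> {}"
  proof
    assume "\<Gamma> s \<inter> \<Gamma> t = {}"
    then have "card (\<Gamma> s \<inter> D) = 0" "card (\<Gamma> s \<inter> Z) = 0" using c by simp_all
    then have "card (\<Gamma> s \<inter> Nx) = \<alpha>" "d = \<alpha> + \<beta>" using sdeg d by simp_all
    moreover have "card (\<Gamma> s \<inter> Nx) < card Nx"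
    proof (rule psubset_card_mono)
      show "\<Gamma> s \<inter> Nx \<subset> Nx" using s self_notin_neighbors[of s] by blast
    qed simp
    ultimately show False using card_Nx \<beta> by linarith
  qed
  then obtain w where "w \<in> \<Gamma> s" "w \<in> \<Gamma> t" by blast
  then have "card (\<Gamma> s \<inter> \<Gamma> t) = \<beta>"
    using st neighbors_sym by (intro codegree_nonadjacent[of _ _ w]) auto
  then have d3: "d + 2 * card (\<Gamma> s \<inter> D) = 3 * \<alpha> + 2" using c d \<beta> by linarith
  have "D = {}"
  proof (rule ccontr)
    assume "D \<noteq> {}"
    then obtain z where "z \<in> D" by blast
    from odd_d[OF this] d3 show False by presburger
  qed
  then show ?thesis using card_D d3 \<beta> by simp
qed

section \<open>Expansion between the private neighbors\<close>

text \<open>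
A common neighbor \<open>z\<close> of \<open>x\<close> and \<open>y\<close> adjacent to a private neighbor \<open>v\<close> of one end would have two
common neighbors with that end, namely \<open>v\<close> and the other end.  So for \<open>\<alpha> \<le> 1\<close> there are no edges
between \<open>D\<close> and the private neighbors, and every private neighbor has \<open>\<beta> - 1\<close> neighbors on the
other side.
\<close>

lemma bipartite_regular_expansion:
  assumes T: "T \<subseteq> Ny" and "\<alpha> \<le> 1" "2 \<le> \<beta>"
  shows "card T \<le> card ((\<Union>t\<in>T. \<Gamma> t) \<inter> Nx)"
proof -
  let ?P = "(\<Union>t\<in>T. \<Gamma> t) \<inter> Nx"
  have fin: "finite T" "finite ?P" using finite_subset[OF T] by auto
  have D0: "card (\<Gamma> v \<inter> D) = 0" if v: "v \<in> Nx \<or> v \<in> Ny" for v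
  proof -
    have "z \<notin> \<Gamma> v" if z: "z \<in> D" for z
    proof
      assume zv: "z \<in> \<Gamma> v"
      have z': "z \<in> \<Gamma> x" "z \<in> \<Gamma> y" "x \<in> \<Gamma> z" "y \<in> \<Gamma> z"
        using z neighbors_sym unfolding common_neighbors_def by blast+
      \<comment> \<open>\<open>u\<close> is the end of the edge \<open>xy\<close> adjacent to \<open>v\<close>, and \<open>u'\<close> is the other end\<close>
      obtain u u' where u: "z \<in> \<Gamma> u" "v \<in> \<Gamma> u" "u' \<in> \<Gamma> u" "u' \<in> \<Gamma> z" "v \<noteq> u'"
      proof (cases "v \<in> Nx")
        case True
        show ?thesis using that[of x y] Nx_adjacency[OF True] xy z' by blast
      next
        case False
        then have "v \<in> Ny" using v by blast
        show ?thesis using that[of y x] Ny_adjacency[OF \<open>v \<in> Ny\<close>] xy z' by blast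
      qed
      have "{v, u'} \<subseteq> \<Gamma> u \<inter> \<Gamma> z" using u zv neighbors_sym by blast
      then have "card {v, u'} \<le> card (\<Gamma> u \<inter> \<Gamma> z)" by (intro card_mono) auto
      then show False using u codegree_adjacent[OF u(1)] \<open>\<alpha> \<le> 1\<close> by simp
    qed
    then show ?thesis by auto
  qed
  have "card (\<Gamma> t \<inter> ?P) = \<beta> - 1" if "t \<in> T" for t
  proof -
    have "\<Gamma> t \<inter> ?P = \<Gamma> t \<inter> Nx" using that by auto
    then show ?thesis using Ny_degrees(1)[of t] D0[of t] that T by auto
  qed
  then have "card T * (\<beta> - 1) = (\<Sum>t\<in>T. card (\<Gamma> t \<inter> ?P))" by simp
  also have "\<dots> = (\<Sum>w\<in>?P. card (\<Gamma> w \<inter> T))" using sum_card_neighbors_swap[OF fin] by simp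
  also have "\<dots> \<le> (\<Sum>w\<in>?P. \<beta> - 1)"
  proof (rule sum_mono)
    fix w assume w: "w \<in> ?P"
    have "card (\<Gamma> w \<inter> T) \<le> card (\<Gamma> w \<inter> Ny)" using T by (intro card_mono) auto
    then show "card (\<Gamma> w \<inter> T) \<le> \<beta> - 1" using Nx_degrees(1)[of w] D0[of w] w by auto
  qed
  finally show ?thesis using \<open>2 \<le> \<beta>\<close> by simp
qed

text \<open>
The right-hand side bounds the sum of the codegrees of all pairs from \<open>T\<close>, which share the neighbor
\<open>y\<close>.  The left-hand side is the lower bound for the same sum by the Cauchy-Schwarz inequality on
\<open>{y}\<close>, the neighbors of \<open>T\<close> in \<open>Nx\<close>, \<open>Ny\<close>, \<open>D\<close> and \<open>Z\<close>; by \<open>Ny_degrees\<close> the number of edges from \<open>T\<close> to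
each of these parts is affine in \<open>E\<close>.
\<close>

lemma square_sum_bound:
  assumes T: "T \<subseteq> Ny" "T \<noteq> {}" and "\<alpha> < \<beta>" "0 < \<alpha>"
    and q: "real (card T) = q + 1" "q > 0" and P: "real (card ((\<Union>t\<in>T. \<Gamma> t) \<inter> Nx)) \<le> q"
  defines "E \<equiv> \<Sum>t\<in>T. real (card (\<Gamma> t \<inter> D))"
  shows "(q + 1)\<^sup>2 + ((q + 1) * (real \<beta> - 1) - E)\<^sup>2 / q + ((q + 1) * real \<alpha> - E)\<^sup>2 / real (card Ny) + E\<^sup>2 / real \<alpha>
      + ((q + 1) * (real d - real \<alpha> - real \<beta>) + E)\<^sup>2 / real (card Ny) \<le> (q + 1) * real d + real \<beta> * (q + 1) * q"
proof -
  let ?P = "(\<Union>t\<in>T. \<Gamma> t) \<inter> Nx"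
  define b where "b w = real (card (\<Gamma> w \<inter> T))" for w
  have fin: "finite T" "finite ?P" using finite_subset[OF T(1)] by auto
  have "card Ny > 0" using T by (auto simp: card_gt_0_iff)
  have part: "(\<Sum>t\<in>T. real (card (\<Gamma> t \<inter> W)))\<^sup>2 / k \<le> (\<Sum>w\<in>W. (b w)\<^sup>2)"
    if "finite W" "real (card W) \<le> k" "k > 0" for W k
  proof -
    have "(\<Sum>t\<in>T. real (card (\<Gamma> t \<inter> W))) = (\<Sum>w\<in>W. b w)"
      unfolding b_def using sum_card_neighbors_swap[OF fin(1) that(1)] by (metis of_nat_sum)
    moreover have "(\<Sum>w\<in>W. b w)\<^sup>2 \<le> real (card W) * (\<Sum>w\<in>W. (b w)\<^sup>2)"
      using sum_squared_le_sum_of_squares[of b W] that by (simp add: mult.commute)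
    moreover have "real (card W) * (\<Sum>w\<in>W. (b w)\<^sup>2) \<le> k * (\<Sum>w\<in>W. (b w)\<^sup>2)"
      using that by (intro mult_right_mono sum_nonneg) auto
    ultimately have "(\<Sum>t\<in>T. real (card (\<Gamma> t \<inter> W)))\<^sup>2 \<le> k * (\<Sum>w\<in>W. (b w)\<^sup>2)" by simp
    then show ?thesis using that(3) by (simp add: field_simps)
  qed
  have deg: "real (card (\<Gamma> t \<inter> ?P)) = real \<beta> - 1 - real (card (\<Gamma> t \<inter> D))"
      "real (card (\<Gamma> t \<inter> Ny)) = real \<alpha> - real (card (\<Gamma> t \<inter> D))"
      "real (card (\<Gamma> t \<inter> Z)) = real d - real \<alpha> - real \<beta> + real (card (\<Gamma> t \<inter> D))" if t: "t \<in> T" for t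
  proof -
    have t': "t \<in> Ny" using t T by blast
    have "\<Gamma> t \<inter> ?P = \<Gamma> t \<inter> Nx" using t by auto
    then show "real (card (\<Gamma> t \<inter> ?P)) = real \<beta> - 1 - real (card (\<Gamma> t \<inter> D))"
      using Ny_degrees(1)[OF t'] by simp
    show "real (card (\<Gamma> t \<inter> Ny)) = real \<alpha> - real (card (\<Gamma> t \<inter> D))"
      using Ny_degrees(2)[OF t'] by simp
    have "real (card (\<Gamma> t \<inter> Z) + \<alpha> + \<beta>) = real (d + card (\<Gamma> t \<inter> D))"
      using Ny_degrees(3)[OF t'] by simp
    then show "real (card (\<Gamma> t \<inter> Z)) = real d - real \<alpha> - real \<beta> + real (card (\<Gamma> t \<inter> D))" by simp
  qed
  have sums: "(\<Sum>t\<in>T. real (card (\<Gamma> t \<inter> ?P))) = (q + 1) * (real \<beta> - 1) - E"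
    "(\<Sum>t\<in>T. real (card (\<Gamma> t \<inter> Ny))) = (q + 1) * real \<alpha> - E"
    "(\<Sum>t\<in>T. real (card (\<Gamma> t \<inter> Z))) = (q + 1) * (real d - real \<alpha> - real \<beta>) + E"
    by (simp_all only: deg sum_subtractf sum.distrib sum_constant q E_def right_diff_distrib mult_1_right cong: sum.cong)
  have y: "(\<Sum>w\<in>{y}. (b w)\<^sup>2) = (q + 1)\<^sup>2"
  proof -
    have "\<Gamma> y \<inter> T = T" using T neighbors_y by blast
    then show ?thesis using q by (simp add: b_def)
  qed
  have "(\<Sum>w\<in>{y}. (b w)\<^sup>2) + (\<Sum>w\<in>?P. (b w)\<^sup>2) + (\<Sum>w\<in>Ny. (b w)\<^sup>2) + (\<Sum>w\<in>D. (b w)\<^sup>2) + (\<Sum>w\<in>Z. (b w)\<^sup>2)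
      = (\<Sum>w\<in>{y} \<union> ?P \<union> Ny \<union> D \<union> Z. (b w)\<^sup>2)"
  proof -
    have disj: "{y} \<inter> ?P = {}" "({y} \<union> ?P) \<inter> Ny = {}" "({y} \<union> ?P \<union> Ny) \<inter> D = {}"
      "({y} \<union> ?P \<union> Ny \<union> D) \<inter> Z = {}"
      using parts_disjoint xy by blast+
    have "finite ({y} \<union> ?P)" "finite ({y} \<union> ?P \<union> Ny)" "finite ({y} \<union> ?P \<union> Ny \<union> D)"
      using fin finite_parts by (simp_all only: finite_Un finite.emptyI finite_insert simp_thms)
    then show ?thesis
      using fin finite_parts disj by (simp only: sum.union_disjoint finite.emptyI finite_insert)
  qed
  also have "\<dots> \<le> (\<Sum>w\<in>verts G. (b w)\<^sup>2)"
  proof (rule sum_mono2)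
    show "{y} \<union> ?P \<union> Ny \<union> D \<union> Z \<subseteq> verts G" using equalityD2[OF verts_eq] by blast
  qed simp_all
  also have "\<dots> = (\<Sum>t\<in>T. \<Sum>t'\<in>T. real (card (\<Gamma> t \<inter> \<Gamma> t')))"
    using arg_cong[OF sum_squares_eq_sum_codegrees[OF fin(1)], of real] by (simp add: b_def)
  also have "\<dots> \<le> (\<Sum>t\<in>T. \<Sum>t'\<in>T. real \<beta> + (if t' = t then real d - real \<beta> else 0))"
  proof (intro sum_mono)
    fix t t' assume t: "t \<in> T" "t' \<in> T"
    then have tD: "t \<in> \<Gamma> y" "t' \<in> \<Gamma> y" "y \<in> \<Gamma> t" "y \<in> \<Gamma> t'" using T Ny_adjacency by blast+
    have "card (\<Gamma> t \<inter> \<Gamma> t') \<le> \<beta>" if "t \<noteq> t'"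
      using codegree_adjacent[of t' t] codegree_nonadjacent[of t t' y] that tD \<open>\<alpha> < \<beta>\<close>
      by (cases "t' \<in> \<Gamma> t") auto
    then show "real (card (\<Gamma> t \<inter> \<Gamma> t')) \<le> real \<beta> + (if t' = t then real d - real \<beta> else 0)"
      using card_neighbors(1)[OF tD(1)] by auto
  qed
  also have "\<dots> = (q + 1) * real d + real \<beta> * (q + 1) * q"
    using fin q by (simp add: sum.distrib algebra_simps)
  finally have total: "(\<Sum>w\<in>{y}. (b w)\<^sup>2) + (\<Sum>w\<in>?P. (b w)\<^sup>2) + (\<Sum>w\<in>Ny. (b w)\<^sup>2) + (\<Sum>w\<in>D. (b w)\<^sup>2) + (\<Sum>w\<in>Z. (b w)\<^sup>2)
      \<le> (q + 1) * real d + real \<beta> * (q + 1) * q" .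
  have "card Z \<le> card Ny" using card_Z card_Ny by linarith
  then have Z: "real (card Z) \<le> real (card Ny)" by simp
  have "real (card Ny) > 0" "real \<alpha> > 0" "real (card D) \<le> real \<alpha>"
    using \<open>card Ny > 0\<close> \<open>0 < \<alpha>\<close> card_D by simp_all
  note bounds = part[OF fin(2) P q(2)] part[OF finite_parts(3) order_refl this(1)]
    part[OF finite_parts(1) this(3,2)] part[OF finite_parts(4) Z this(1)]
  show ?thesis
    using total bounds unfolding sums y E_def[symmetric] by linarith
qed

text \<open>
Hall's condition for sets of at most half of \<open>d - \<alpha>\<close> vertices.  The counting in \<open>square_sum_bound\<close> divides by
\<open>card T - 1\<close>, so a violator of size one is treated by \<open>isolated_private_neighbor\<close>.
\<close>

lemma small_set_expansion:
  assumes adm: "admissible_parameters d \<alpha> \<beta>" and T: "T \<subseteq> Ny" and small: "2 * card T \<le> d - \<alpha>"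
  shows "card T \<le> card ((\<Union>t\<in>T. \<Gamma> t) \<inter> Nx)"
proof (rule ccontr)
  let ?P = "(\<Union>t\<in>T. \<Gamma> t) \<inter> Nx"
  assume "\<not> card T \<le> card ?P"
  then have viol: "card ?P < card T" by simp
  have \<alpha>\<beta>: "\<alpha> < \<beta>" using adm by (simp add: admissible_parameters_def)
  have fin: "finite T" "finite ?P" using finite_subset[OF T] by auto
  have no_iso: "\<Gamma> t \<inter> Nx \<noteq> {}" if "t \<in> Ny" for t
  proof
    assume "\<Gamma> t \<inter> Nx = {}"
    from isolated_private_neighbor[OF that this \<alpha>\<beta>] adm show False by (simp add: admissible_parameters_def)
  qed
  obtain t where t: "t \<in> T" using viol by fastforce
  then have t': "t \<in> Ny" using T by blast
  from no_iso[OF t'] have "?P \<noteq> {}" using t by blast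
  then have "card ?P > 0" using fin by (simp add: card_gt_0_iff)
  then have T2: "card T \<ge> 2" using viol by linarith
  have "\<beta> \<noteq> 1" using no_iso[OF t'] Ny_degrees(1)[OF t'] by auto
  moreover have "\<not> (\<alpha> \<le> 1 \<and> 2 \<le> \<beta>)" using bipartite_regular_expansion[OF T] viol by linarith
  ultimately have a2: "2 \<le> \<alpha>"
    and lp: "large_parameters (real \<alpha>) (real \<beta> - real \<alpha> - 1) (real d - real \<alpha> - 1)"
    using adm by (auto simp: admissible_parameters_def)
  define q where "q = real (card T) - 1"
  define N where "N = real (card Ny)"
  define E where "E = (\<Sum>t\<in>T. real (card (\<Gamma> t \<inter> D)))"
  define j where "j = d - \<alpha> - 2 * card T"
  have q: "real (card T) = q + 1" "q \<ge> 1" "q > 0" using T2 by (simp_all add: q_def)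
  have N: "real d = N + 1 + real \<alpha>" "N > 0"
    using card_Ny t' by (auto simp: N_def card_gt_0_iff)
  have Nj: "N = 2 * q + 1 + real j"
    using small card_Ny unfolding j_def N_def q_def by (simp add: of_nat_diff)
  have "real (card ?P) \<le> q" using viol unfolding q_def by linarith
  from square_sum_bound[OF T _ \<alpha>\<beta> _ q(1,3) this] t a2
  have "(q + 1)\<^sup>2 + ((q + 1) * (real \<beta> - 1) - E)\<^sup>2 / q + ((q + 1) * real \<alpha> - E)\<^sup>2 / N + E\<^sup>2 / real \<alpha>
      + ((q + 1) * (real d - real \<alpha> - real \<beta>) + E)\<^sup>2 / N \<le> (q + 1) * real d + real \<beta> * (q + 1) * q"
    unfolding E_def N_def by auto
  from normalised_square_sum_bound[OF _ q(3) N(2,1) this] a2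
  have ineq: "(N - (real \<beta> - real \<alpha> - 1)) * q / (q + 1) + (1 / real \<alpha> + 1 / N) * (real \<alpha> - E / (q + 1))\<^sup>2
      + (1 / N + 1 / q) * ((real \<alpha> - E / (q + 1)) + (real \<beta> - real \<alpha> - 1))\<^sup>2
    \<le> 4 * (real \<alpha> - E / (q + 1)) + 2 * (real \<beta> - real \<alpha> - 1)"
    by simp
  show False
  proof (rule parameters_exclude_blocking_set[OF _ _ q(2) _ Nj _ _ ineq])
    show "large_parameters (real \<alpha>) (real \<beta> - real \<alpha> - 1) N" using lp N by simp
    show "real \<alpha> \<ge> 2" using a2 by simp
    show "real j = 0 \<or> real j = 1 \<or> real j = 2 \<or> real j \<ge> 3" by (auto simp: numeral_eq_Suc)
    show "0 \<le> real \<beta> - real \<alpha> - 1" using \<alpha>\<beta> by simp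
    show "real \<beta> - real \<alpha> - 1 \<le> N" using Ny_degrees(4)[OF t'] N by simp
  qed
qed


text \<open>
A set \<open>X\<close> violating Hall's condition with more than half of \<open>d - \<alpha>\<close> vertices is traded for a small
one on the other side: the vertices of \<open>Ny\<close> without neighbors in \<open>X\<close> are too many for the rest of
\<open>Nx\<close>, and they can be cut down to \<open>d - \<alpha> - card X\<close> of them.
\<close>

lemma ex_perfect_matching:
  assumes adm: "admissible_parameters d \<alpha> \<beta>"
  shows "\<exists>M. perfect_matching_between G Nx Ny M"
proof -
  interpret swap: amply_regular_edge G n d \<alpha> \<beta> y x by (rule swap_edge)
  have hall: "card X \<le> card (\<Union>s\<in>X. \<Gamma> s \<inter> Ny)" if X: "X \<subseteq> Nx" for X
  proof (rule ccontr)
    let ?N = "\<Union>s\<in>X. \<Gamma> s \<inter> Ny"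
    assume "\<not> card X \<le> card ?N"
    then have viol: "card ?N < card X" by simp
    have "?N = (\<Union>s\<in>X. \<Gamma> s) \<inter> Ny" by blast
    then have large: "2 * card X > d - \<alpha>"
      using swap.small_set_expansion[OF adm X] viol by fastforce
    have cX: "card X \<le> card Nx" using X by (intro card_mono) auto
    have "?N \<subseteq> Ny" by blast
    then have "card (Ny - ?N) = card Ny - card ?N" using finite_subset by (intro card_Diff_subset) auto
    then have "card (Ny - ?N) \<ge> d - \<alpha> - card X" using viol card_Ny by linarith
    then obtain T where T: "T \<subseteq> Ny - ?N" "card T = d - \<alpha> - card X"
      using obtain_subset_with_card_n by metis
    have "(\<Union>t\<in>T. \<Gamma> t) \<inter> Nx \<subseteq> Nx - X" using T neighbors_sym by blast
    then have "card ((\<Union>t\<in>T. \<Gamma> t) \<inter> Nx) \<le> card (Nx - X)" by (intro card_mono) auto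
    also have "\<dots> = card Nx - card X" using finite_subset[OF X] X by (intro card_Diff_subset) auto
    finally have "card ((\<Union>t\<in>T. \<Gamma> t) \<inter> Nx) \<le> card Nx - card X" .
    moreover have "card T \<le> card ((\<Union>t\<in>T. \<Gamma> t) \<inter> Nx)"
      using T large by (intro small_set_expansion[OF adm]) auto
    ultimately show False using T(2) cX card_Nx by linarith
  qed
  have "\<exists>f. inj_on f Nx \<and> (\<forall>s\<in>Nx. f s \<in> \<Gamma> s \<inter> Ny)"
    by (rule hall_marriage) (use hall in auto)
  then obtain f where f: "inj_on f Nx" "\<And>s. s \<in> Nx \<Longrightarrow> f s \<in> \<Gamma> s \<inter> Ny" by blast
  have "f ` Nx = Ny"
    using f card_Nx card_Ny by (intro card_seteq) (auto simp: card_image)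
  then have "Nx \<union> Ny \<subseteq> \<Union> ((\<lambda>s. {s, f s}) ` Nx)" by blast
  moreover have "disjoint ((\<lambda>s. {s, f s}) ` Nx)"
  proof (rule disjointI)
    fix e e' assume "e \<in> (\<lambda>s. {s, f s}) ` Nx" "e' \<in> (\<lambda>s. {s, f s}) ` Nx" "e \<noteq> e'"
    then obtain s s' where "s \<in> Nx" "s' \<in> Nx" "s \<noteq> s'" "e = {s, f s}" "e' = {s', f s'}" by blast
    then show "e \<inter> e' = {}" using f parts_disjoint(12) by (auto dest: inj_onD)
  qed
  moreover have "\<forall>e \<in> (\<lambda>s. {s, f s}) ` Nx. \<exists>u \<in> Nx. \<exists>v \<in> Ny. u \<rightarrow> v \<and> e = {u, v}"
    using f(2) neighbors_iff by blast
  ultimately show ?thesis unfolding perfect_matching_between_def by blast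
qed

end

section \<open>Perfect matchings between private neighbors\<close>

theorem theorem1p3:
  fixes G :: "('a, 'b) pre_digraph"
    and n d \<alpha> \<beta> :: nat
  assumes "amply_regular G n d \<alpha> \<beta>"
    and "int n < 3 * int d - 2 * int \<alpha>"
    and "(\<beta> = \<alpha> + 1 \<and> real d > real \<alpha> + sqrt (6 * real \<alpha> + 1 / 4) + 3 / 2)
       \<or> (\<beta> \<ge> \<alpha> + 2
           \<and> 4 * (real \<alpha>)\<^sup>2 - 3 * (real \<beta>)\<^sup>2 + 28 * real \<beta> \<ge> 0
           \<and> real d \<ge> 3 / 2 * real \<beta>
               + 1 / 2 * sqrt (4 * (real \<alpha>)\<^sup>2 - 3 * (real \<beta>)\<^sup>2 + 28 * real \<beta>))
       \<or> (real \<beta> \<ge> 2 * sqrt 3 / 3 * real \<alpha> + 7)"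
  shows "\<forall>x y. x \<rightarrow>\<^bsub>G\<^esub> y \<longrightarrow>
    (\<exists>M. perfect_matching_between G (private_neighbors G x y) (private_neighbors G y x) M)"
proof (intro allI impI)
  fix x y assume xy: "x \<rightarrow>\<^bsub>G\<^esub> y"
  let ?\<Delta> = "4 * (real \<alpha>)\<^sup>2 - 3 * (real \<beta>)\<^sup>2 + 28 * real \<beta>"
  have "admissible_parameters d \<alpha> \<beta>"
    using assms(3)
  proof (elim disjE conjE)
    assume "\<beta> \<ge> \<alpha> + 2" "?\<Delta> \<ge> 0" and d: "real d \<ge> 3 / 2 * real \<beta> + 1 / 2 * sqrt ?\<Delta>"
    have "sqrt ?\<Delta> \<le> 2 * real d - 3 * real \<beta>" using d by simp
    then have "(sqrt ?\<Delta>)\<^sup>2 \<le> (2 * real d - 3 * real \<beta>)\<^sup>2" using \<open>?\<Delta> \<ge> 0\<close> by (intro power_mono) auto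
    then show ?thesis using \<open>\<beta> \<ge> \<alpha> + 2\<close> \<open>?\<Delta> \<ge> 0\<close> by (intro admissible_parameters_if_discriminant_small) simp_all
  qed (auto intro: admissible_parameters_if_degree_large admissible_parameters_if_beta_large)
  moreover have "amply_regular_edge G n d \<alpha> \<beta> x y"
    using assms(1,2) xy by (auto simp: amply_regular_edge_def amply_regular_edge_axioms_def)
  ultimately show "\<exists>M. perfect_matching_between G (private_neighbors G x y) (private_neighbors G y x) M"
    by (rule amply_regular_edge.ex_perfect_matching[rotated])
qed

end
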